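(* Let $\beta>0$ and $\mathcal G_\beta(x)=\gamma\|x\|_D-\mathfrak r^\top x+\beta\|x\|_0$. Then the set of global minimizers of $\mathcal G_\beta$ over $\mathcal Y=\{x\in\mathbb R^N:\|x\|_D\le T\}$, $$\hat Y=\left\{\hat x\in\mathcal Y:\ \mathcal G_\beta(\hat x)=\min_{x\in\mathcal Y}\mathcal G_\beta(x)\right\},$$ is nonempty.
   Context: Data: $N\ge 1$; $D\in\mathbb R^{N\times N}$ is a symmetric positive definite matrix with diagonal entries $D_{ii}$; $\hat r\in\mathbb R^N$; $r_c\in\mathbb R$; $\gamma>0$; $T>0$. Set $\mathfrak r=\hat r-r_c\mathbf 1\in\mathbb R^N$ (with entries $\mathfrak r[i]$, where $\mathbf 1$ is the all-ones vector). Notation: $\|x\|_D=\sqrt{x^\top D x}$; $\|x\|_0$ is the number of nonzero entries of $x$. Standing assumptions: $\min_{1\le i\le N}|\mathfrak r[i]|/\sqrt{D_{ii}}>\gamma$, and $T>\min_{1\le i\le N}\dfrac{\sqrt{D_{ii}}\,\beta}{|\mathfrak r[i]|-\sqrt{D_{ii}}\,\gamma}$. *)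

theory Defs
  imports "HOL-Analysis.Analysis"
begin

definition sym_pos_def :: "real ^ 'n ^ 'n \<Rightarrow> bool" where
  "sym_pos_def D \<longleftrightarrow> transpose D = D \<and> (\<forall>x. x \<noteq> 0 \<longrightarrow> x \<bullet> (D *v x) > 0)"

definition norm_wrt :: "real ^ 'n ^ 'n \<Rightarrow> real ^ 'n \<Rightarrow> real" where
  "norm_wrt D x = sqrt (x \<bullet> (D *v x))"

definition norm0 :: "real ^ 'n \<Rightarrow> nat" where
  "norm0 x = card {i. x $ i \<noteq> 0}"

(* The numeral 1 at type real ^ 'n is the all-ones vector (one_vec_def). *)
definition excess :: "real ^ 'n \<Rightarrow> real \<Rightarrow> real ^ 'n" where
  "excess rhat rc = rhat - rc *\<^sub>R 1"

definition G_obj :: "real ^ 'n ^ 'n \<Rightarrow> real ^ 'n \<Rightarrow> real \<Rightarrow> real \<Rightarrow> real ^ 'n \<Rightarrow> real" where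
  "G_obj D r \<gamma> \<beta> x = \<gamma> * norm_wrt D x - r \<bullet> x + \<beta> * real (norm0 x)"

definition feasible :: "real ^ 'n ^ 'n \<Rightarrow> real \<Rightarrow> (real ^ 'n) set" where
  "feasible D T = {x. norm_wrt D x \<le> T}"

definition global_minimizers :: "('a \<Rightarrow> real) \<Rightarrow> 'a set \<Rightarrow> 'a set" where
  "global_minimizers f S = {x \<in> S. \<forall>y \<in> S. f x \<le> f y}"

end

theory Submission
  imports Defs
begin

text \<open>
  The counting term \<open>norm0\<close> is discontinuous, but it depends only on the support of the vector, and
  there are finitely many supports. On the closed set of vectors that vanish outside a given index
  set \<open>S\<close>, the penalty is at most \<open>\<beta> * card S\<close>, with equality when the support is exactly \<open>S\<close>.
  Replacing it by that constant leaves a continuous objective, which has a minimizer over a compact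
  set. The best of these finitely many minimizers is a global one: passing from \<open>\<beta> * card S\<close> back to
  the true penalty can only lower its value, and any competitor \<open>y\<close> was already beaten when \<open>S\<close> was
  the support of \<open>y\<close> (lemma \<open>l0_penalized_attains_min\<close>).

  The ellipsoid \<open>feasible D T\<close> is compact because a positive definite form is bounded below by a
  positive multiple of the squared Euclidean norm.
\<close>

lemma continuous_on_quadratic_form:
  fixes D :: "real ^ 'n ^ 'n"
  shows "continuous_on A (\<lambda>x. x \<bullet> (D *v x))"
  by (intro continuous_intros linear_continuous_on matrix_vector_mul_bounded_linear)

text \<open>Homogeneity reduces the bound to the unit sphere, where \<open>c\<close> is the minimum of the form.\<close>

lemma sym_pos_def_coercive:
  fixes D :: "real ^ 'n ^ 'n"
  assumes "sym_pos_def D"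
  obtains c where "c > 0" and "\<And>x. c * (norm x)\<^sup>2 \<le> x \<bullet> (D *v x)"
proof -
  let ?q = "\<lambda>x. x \<bullet> (D *v x)"
  have "sphere (0 :: real ^ 'n) 1 \<noteq> {}"
    by simp
  then obtain u where u: "u \<in> sphere 0 1" and umin: "\<And>y. y \<in> sphere 0 1 \<Longrightarrow> ?q u \<le> ?q y"
    using continuous_attains_inf[OF compact_sphere _ continuous_on_quadratic_form] by metis
  show thesis
  proof
    show "?q u > 0"
      using u assms unfolding sym_pos_def_def
      by (metis mem_sphere_0 norm_zero zero_neq_one)
    fix x :: "real ^ 'n"
    show "?q u * (norm x)\<^sup>2 \<le> ?q x"
    proof (cases "x = 0")
      case False
      then have "?q u \<le> ?q (x /\<^sub>R norm x)"
        by (intro umin) simp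
      also have "\<dots> = ?q x / (norm x)\<^sup>2"
        by (simp add: matrix_vector_mult_scaleR power2_eq_square divide_inverse)
      finally show ?thesis
        using False by (simp add: field_simps)
    qed simp
  qed
qed

lemma compact_feasible:
  fixes D :: "real ^ 'n ^ 'n"
  assumes "sym_pos_def D"
  shows "compact (feasible D T)"
proof -
  obtain c where c: "c > 0" and coercive: "\<And>x. c * (norm x)\<^sup>2 \<le> x \<bullet> (D *v x)"
    using sym_pos_def_coercive[OF assms] by blast
  have "norm x \<le> T / sqrt c" if "x \<in> feasible D T" for x
  proof -
    have "sqrt c * norm x = sqrt (c * (norm x)\<^sup>2)"
      by (simp add: real_sqrt_mult)
    also have "\<dots> \<le> T"
      using that real_sqrt_le_mono[OF coercive[of x]]
      unfolding feasible_def norm_wrt_def mem_Collect_eq by (rule order_trans[rotated])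
    finally show ?thesis
      using c by (simp add: field_simps)
  qed
  then have "bounded (feasible D T)"
    by (meson boundedI)
  moreover have "closed (feasible D T)"
    unfolding feasible_def norm_wrt_def
    by (intro closed_Collect_le continuous_intros continuous_on_quadratic_form)
  ultimately show ?thesis
    by (simp add: compact_eq_bounded_closed)
qed

lemma l0_penalized_attains_min:
  fixes h :: "real ^ 'n \<Rightarrow> real"
  assumes "compact K" and "K \<noteq> {}" and "continuous_on K h" and "\<beta> \<ge> 0"
  shows "\<exists>x\<in>K. \<forall>y\<in>K. h x + \<beta> * real (norm0 x) \<le> h y + \<beta> * real (norm0 y)"
proof -
  define supp where "supp x = {i. x $ i \<noteq> 0}" for x :: "real ^ 'n"
  define face where "face S = K \<inter> {x. \<forall>i\<in>-S. x $ i = 0}" for S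
  have "\<exists>x\<in>face S. \<forall>y\<in>face S. h x \<le> h y" if "S \<in> supp ` K" for S
  proof (rule continuous_attains_inf)
    have "closed {x :: real ^ 'n. \<forall>i\<in>-S. x $ i = 0}"
      unfolding Ball_def
      by (intro closed_Collect_all closed_Collect_imp closed_Collect_eq continuous_intros) simp
    then show "compact (face S)"
      unfolding face_def using assms(1) by (rule compact_Int_closed[rotated])
    show "face S \<noteq> {}"
      using that by (auto simp: face_def supp_def)
    show "continuous_on (face S) h"
      using assms(3) by (rule continuous_on_subset) (auto simp: face_def)
  qed
  then obtain m where m: "\<And>S. S \<in> supp ` K \<Longrightarrow> m S \<in> face S"
      and mmin: "\<And>S y. S \<in> supp ` K \<Longrightarrow> y \<in> face S \<Longrightarrow> h (m S) \<le> h y"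
    by metis
  define cost where "cost S = h (m S) + \<beta> * real (card S)" for S
  have fin: "finite (supp ` K)" "supp ` K \<noteq> {}"
    using \<open>K \<noteq> {}\<close> by (simp_all add: finite_subset[OF subset_UNIV])
  obtain S where S: "S \<in> supp ` K" and Smin: "\<And>S'. S' \<in> supp ` K \<Longrightarrow> cost S \<le> cost S'"
    using arg_min_if_finite(1)[OF fin, of cost] arg_min_least[OF fin, of _ cost] by blast
  show ?thesis
  proof (intro bexI ballI)
    show "m S \<in> K"
      using m[OF S] by (simp add: face_def)
    fix y assume y: "y \<in> K"
    have "supp (m S) \<subseteq> S"
      using m[OF S] by (auto simp: face_def supp_def)
    then have "norm0 (m S) \<le> card S"
      unfolding norm0_def supp_def by (intro card_mono) auto
    then have "h (m S) + \<beta> * real (norm0 (m S)) \<le> cost S"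
      using \<open>\<beta> \<ge> 0\<close> by (simp add: cost_def mult_left_mono)
    also have "\<dots> \<le> cost (supp y)"
      using y by (intro Smin) simp
    also have "\<dots> \<le> h y + \<beta> * real (norm0 y)"
      using mmin[of "supp y" y] y by (simp add: cost_def face_def supp_def norm0_def)
    finally show "h (m S) + \<beta> * real (norm0 (m S)) \<le> h y + \<beta> * real (norm0 y)" .
  qed
qed

theorem theorem4:
  fixes D :: "real ^ 'n ^ 'n" and rhat r :: "real ^ 'n" and rc \<gamma> T \<beta> :: real
  assumes "sym_pos_def D"
    and "\<gamma> > 0" and "T > 0" and "\<beta> > 0"
    and "r = excess rhat rc"
    and "(MIN i. \<bar>r $ i\<bar> / sqrt (D $ i $ i)) > \<gamma>"
    and "T > (MIN i. sqrt (D $ i $ i) * \<beta> / (\<bar>r $ i\<bar> - sqrt (D $ i $ i) * \<gamma>))"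
  shows "global_minimizers (G_obj D r \<gamma> \<beta>) (feasible D T) \<noteq> {}"
proof -
  let ?h = "\<lambda>x. \<gamma> * norm_wrt D x - r \<bullet> x"
  have "0 \<in> feasible D T"
    using \<open>T > 0\<close> by (simp add: feasible_def norm_wrt_def)
  moreover have "continuous_on (feasible D T) ?h"
    unfolding norm_wrt_def by (intro continuous_intros continuous_on_quadratic_form)
  ultimately have "\<exists>x\<in>feasible D T. \<forall>y\<in>feasible D T.
      ?h x + \<beta> * real (norm0 x) \<le> ?h y + \<beta> * real (norm0 y)"
    using compact_feasible[OF \<open>sym_pos_def D\<close>] \<open>\<beta> > 0\<close>
    by (intro l0_penalized_attains_min) auto
  then show ?thesis
    by (auto simp: global_minimizers_def G_obj_def)
qed

end
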